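(* Let $A_0,\ldots,A_N\in\mathbb{R}^{n\times n}$ and, for integer delays $\tau_1,\ldots,\tau_N\ge0$ with $\bar\tau=\max_i\tau_i$, consider the stochastic system with delays $$x(k+1)=A_0x(k)+\sum_{i=1}^N\nu_i(k)A_ix(k-\tau_i),\quad k\ge0,\qquad x(s)=\phi(s),\ s\in\{-\bar\tau,\ldots,0\},\qquad(\ast)$$ where $x(k)\in\mathbb{R}^n$ is the state of the system, $\phi:\{-\bar\tau,\ldots,0\}\to\mathbb{R}^n$ is the initial condition, and the zero mean and unit variance random signals $\nu_1(k),\ldots,\nu_N(k)$ are independent of each other and of the state $x(k)$. The following statements are equivalent: (a) The system $(\ast)$ is mean-square exponentially stable for all $\tau_i\ge0$, $i=1,\ldots,N$. (b) The system $(\ast)$ with zero delays (i.e. with $\tau_i=0$ for all $i=1,\ldots,N$) is mean-square exponentially stable.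
   Context: For given delays, the system is mean-square exponentially stable if there exist $\rho\in(0,1)$ and $\beta>1$ such that $$\mathbb{E}[\|x(k)\|_2^2]\le\beta\rho^k\,\mathbb{E}\Big[\max_{s\in\{-\bar\tau,\ldots,0\}}\|\phi(s)\|_2^2\Big]$$ for all $k\ge0$ and all initial conditions $\phi:\{-\bar\tau,\ldots,0\}\to\mathbb{R}^n$. *)

theory Defs
  imports "HOL-Probability.Probability"
begin

(* The inserted 0 does not change the maximum of nonnegative delays; it only gives the
   system without delayed terms (N = 0) the maximal delay 0. *)
definition max_delay :: "nat \<Rightarrow> (nat \<Rightarrow> nat) \<Rightarrow> nat" where
  "max_delay N \<tau> = Max (insert 0 (\<tau> ` {1..N}))"

definition init_times :: "nat \<Rightarrow> (nat \<Rightarrow> nat) \<Rightarrow> int set" where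
  "init_times N \<tau> = {- int (max_delay N \<tau>)..0}"

(* The solution of the delay system as a process in integer time. It takes the values of phi at
   all times t <= 0, but at times t >= 1 it depends on phi only through its restriction to
   init_times. The recursion appears below, in delay_state_step, with k and k + 1 in place of
   t - 1 and t. *)
function delay_state ::
  "nat \<Rightarrow> (nat \<Rightarrow> real^'n^'n) \<Rightarrow> (nat \<Rightarrow> nat \<Rightarrow> 'w \<Rightarrow> real) \<Rightarrow> (nat \<Rightarrow> nat)
    \<Rightarrow> (int \<Rightarrow> 'w \<Rightarrow> real^'n) \<Rightarrow> int \<Rightarrow> 'w \<Rightarrow> real^'n" where
  "delay_state N A \<nu> \<tau> \<phi> t \<omega> =
    (if t \<le> 0 then \<phi> t \<omega>
     else A 0 *v delay_state N A \<nu> \<tau> \<phi> (t - 1) \<omega>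
       + (\<Sum>i = 1..N. \<nu> i (nat (t - 1)) \<omega> *\<^sub>R
            (A i *v delay_state N A \<nu> \<tau> \<phi> (t - 1 - int (\<tau> i)) \<omega>)))"
  by pat_completeness auto
termination
  by (relation "Wellfounded.measure (\<lambda>(N, A, \<nu>, \<tau>, \<phi>, t, \<omega>). nat t)") auto

declare delay_state.simps [simp del]

lemma delay_state_init: "s \<le> 0 \<Longrightarrow> delay_state N A \<nu> \<tau> \<phi> s \<omega> = \<phi> s \<omega>"
  by (subst delay_state.simps) simp

lemma delay_state_step:
  "delay_state N A \<nu> \<tau> \<phi> (int k + 1) \<omega> =
     A 0 *v delay_state N A \<nu> \<tau> \<phi> (int k) \<omega>
     + (\<Sum>i = 1..N. \<nu> i k \<omega> *\<^sub>R (A i *v delay_state N A \<nu> \<tau> \<phi> (int k - int (\<tau> i)) \<omega>))"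
  by (subst delay_state.simps) simp

(* Independence of random variables X and Y with possibly different codomains; the library's
   indep_var requires a common type of values. *)
definition indep_rv ::
  "'w measure \<Rightarrow> 'a measure \<Rightarrow> ('w \<Rightarrow> 'a) \<Rightarrow> 'b measure \<Rightarrow> ('w \<Rightarrow> 'b) \<Rightarrow> bool" where
  "indep_rv M S X T Y \<longleftrightarrow>
     X \<in> measurable M S \<and> Y \<in> measurable M T \<and>
     prob_space.indep_set M {X -` B \<inter> space M |B. B \<in> sets S} {Y -` C \<inter> space M |C. C \<in> sets T}"

definition zero_mean_unit_variance :: "'w measure \<Rightarrow> nat \<Rightarrow> (nat \<Rightarrow> nat \<Rightarrow> 'w \<Rightarrow> real) \<Rightarrow> bool" where
  "zero_mean_unit_variance M N \<nu> \<longleftrightarrow>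
     (\<forall>i\<in>{1..N}. \<forall>k.
        \<nu> i k \<in> borel_measurable M \<and> integrable M (\<lambda>\<omega>. (\<nu> i k \<omega>)\<^sup>2) \<and>
        prob_space.expectation M (\<nu> i k) = 0 \<and> prob_space.variance M (\<nu> i k) = 1)"

(* For every k, the noises nu_1(k), ..., nu_N(k) are mutually independent and jointly independent
   of the state of the delay system at time k, i.e. of the segment x(k - max_delay), ..., x(k)
   that determines the further evolution. For zero delays this segment is just x(k).
   Whiteness in time is not demanded separately. *)
definition noise_state_indep ::
  "'w measure \<Rightarrow> nat \<Rightarrow> (nat \<Rightarrow> real^'n^'n) \<Rightarrow> (nat \<Rightarrow> nat \<Rightarrow> 'w \<Rightarrow> real) \<Rightarrow> (nat \<Rightarrow> nat)
    \<Rightarrow> (int \<Rightarrow> 'w \<Rightarrow> real^'n) \<Rightarrow> bool" where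
  "noise_state_indep M N A \<nu> \<tau> \<phi> \<longleftrightarrow>
     (\<forall>k::nat.
        prob_space.indep_vars M (\<lambda>_. borel) (\<lambda>i. \<nu> i k) {1..N} \<and>
        indep_rv M
          (Pi\<^sub>M {1..N} (\<lambda>_. borel)) (\<lambda>\<omega>. \<lambda>i\<in>{1..N}. \<nu> i k \<omega>)
          (Pi\<^sub>M {int k - int (max_delay N \<tau>)..int k} (\<lambda>_. borel))
          (\<lambda>\<omega>. \<lambda>s\<in>{int k - int (max_delay N \<tau>)..int k}. delay_state N A \<nu> \<tau> \<phi> s \<omega>))"

(* Initial conditions may be random, subject to the standing independence assumption;
   deterministic ones are the special case of phi not depending on the sample point.
   Expectations of squared norms are taken as extended nonnegative integrals, so that an
   infinite second moment counts as infinity. *)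
definition ms_exp_stable ::
  "'w measure \<Rightarrow> nat \<Rightarrow> (nat \<Rightarrow> real^'n^'n) \<Rightarrow> (nat \<Rightarrow> nat \<Rightarrow> 'w \<Rightarrow> real) \<Rightarrow> (nat \<Rightarrow> nat) \<Rightarrow> bool" where
  "ms_exp_stable M N A \<nu> \<tau> \<longleftrightarrow>
     (\<exists>\<rho> \<beta>. 0 < \<rho> \<and> \<rho> < 1 \<and> 1 < \<beta> \<and>
        (\<forall>\<phi>. (\<forall>s\<in>init_times N \<tau>. \<phi> s \<in> borel_measurable M) \<and> noise_state_indep M N A \<nu> \<tau> \<phi> \<longrightarrow>
           (\<forall>k::nat.
              (\<integral>\<^sup>+\<omega>. ennreal ((norm (delay_state N A \<nu> \<tau> \<phi> (int k) \<omega>))\<^sup>2) \<partial>M)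
              \<le> ennreal (\<beta> * \<rho> ^ k) *
                (\<integral>\<^sup>+\<omega>. ennreal (MAX s\<in>init_times N \<tau>. (norm (\<phi> s \<omega>))\<^sup>2) \<partial>M))))"

end

theory Submission
  imports Defs
begin

text \<open>
  Put \<open>A\<^sub>0\<close> on the same footing as the other matrices by giving it delay 0 and constant gain 1, and let
  \<open>L G = \<Sum>\<^sub>i A\<^sub>i\<^sup>T G A\<^sub>i\<close>. The gains are orthonormal in mean square and independent of the state, so
  \<open>E[x(k+1)\<^sup>T G x(k+1)] = \<Sum>\<^sub>i E[x(k-\<tau>\<^sub>i)\<^sup>T A\<^sub>i\<^sup>T G A\<^sub>i x(k-\<tau>\<^sub>i)]\<close>. With zero delays and \<open>x(0) = c\<close> this gives
  \<open>E|x(k)|\<^sup>2 = c\<^sup>T L\<^sup>k(1) c\<close>, so stability yields \<open>m > 0\<close> with \<open>L\<^sup>m(1) \<le> 1/2\<close>, and \<open>P = \<Sum>\<^sub>k\<^sub><\<^sub>m L\<^sup>k(1)\<close> satisfies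
  \<open>P \<ge> 1\<close> and \<open>L P \<le> P - 1/2\<close>. For arbitrary delays, \<open>V(k) = E[x(k)\<^sup>T P x(k)]\<close> plus a geometrically weighted
  sum of the terms \<open>E[x(s)\<^sup>T A\<^sub>i\<^sup>T P A\<^sub>i x(s)]\<close> still stored in the delay lines decays geometrically.
\<close>

section \<open>Matrices and bilinear forms\<close>

lemma borel_measurable_matrix_vector_mult [measurable]:
  fixes A :: "real^'n^'m" and f :: "'a \<Rightarrow> real^'n"
  assumes "f \<in> borel_measurable M"
  shows "(\<lambda>x. A *v f x) \<in> borel_measurable M"
  by (rule measurable_compose[OF assms])
    (intro borel_measurable_continuous_onI matrix_vector_mult_linear_continuous_on)

text \<open>Rewrites a cross term of transformed states as a bilinear form in the states themselves,
  so that \<open>square_integrable_bilinear\<close> covers all of them.\<close>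

lemma inner_matrix_congruence:
  fixes A B G :: "real^'n^'n"
  shows "(A *v x) \<bullet> (G *v (B *v y)) = x \<bullet> ((transpose A ** G ** B) *v y)"
  by (metis dot_lmul_matrix matrix_vector_mul_assoc transpose_matrix_vector transpose_transpose)

lemma matrix_vector_mult_sum_left:
  fixes B :: "'i \<Rightarrow> real^'n^'m"
  shows "(\<Sum>i\<in>I. B i) *v x = (\<Sum>i\<in>I. B i *v x)"
  by (induction I rule: infinite_finite_induct) (simp_all add: matrix_vector_mult_add_rdistrib)

lemma matrix_bilinear_bound:
  fixes G :: "real^'n^'n"
  obtains C where "0 < C" "\<And>x y. \<bar>x \<bullet> (G *v y)\<bar> \<le> C * (norm x * norm y)"
proof
  \<comment> \<open>The 1 added to the operator norm keeps the constant positive even for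
    \<open>G = 0\<close>.\<close>
  show "0 < onorm ((*v) G) + 1"
    by (simp add: onorm_pos_le matrix_vector_mul_bounded_linear add_nonneg_pos)
  fix x y
  have "\<bar>x \<bullet> (G *v y)\<bar> \<le> norm x * norm (G *v y)" by (rule Cauchy_Schwarz_ineq2)
  also have "\<dots> \<le> norm x * (onorm ((*v) G) * norm y)"
    by (intro mult_left_mono onorm matrix_vector_mul_bounded_linear) auto
  also have "\<dots> \<le> (onorm ((*v) G) + 1) * (norm x * norm y)"
    by (simp add: algebra_simps)
  finally show "\<bar>x \<bullet> (G *v y)\<bar> \<le> (onorm ((*v) G) + 1) * (norm x * norm y)" .
qed

section \<open>The Lyapunov operator\<close>

text \<open>With zero delays this is the dual of the evolution of the second moment matrix
  \<open>E[x x^T]\<close>: the form \<open>lyap_op N A G\<close> at time k has the same expectation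
  as the form \<open>G\<close> at time k + 1.\<close>

definition lyap_op :: "nat \<Rightarrow> (nat \<Rightarrow> real^'n^'n) \<Rightarrow> real^'n^'n \<Rightarrow> real^'n^'n" where
  "lyap_op N A G = (\<Sum>i = 0..N. transpose (A i) ** G ** A i)"

lemma inner_lyap_op:
  "x \<bullet> (lyap_op N A G *v y) = (\<Sum>i = 0..N. (A i *v x) \<bullet> (G *v (A i *v y)))"
  by (simp add: lyap_op_def matrix_vector_mult_sum_left inner_sum_right inner_matrix_congruence)

lemma lyap_op_pow_nonneg: "0 \<le> x \<bullet> ((lyap_op N A ^^ k) (mat 1) *v x)"
  by (induction k arbitrary: x) (auto simp: inner_lyap_op intro: sum_nonneg)

text \<open>\<open>P\<close> truncates the Neumann series for the equation
  \<open>P - L P = 1\<close>. Telescoping gives \<open>L P - P = L^m(1) - 1\<close>, and the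
  contraction bounds the remainder \<open>L^m(1)\<close> by one half.\<close>

lemma lyapunov_matrix:
  fixes A :: "nat \<Rightarrow> real^'n^'n"
  assumes "\<And>c. c \<bullet> ((lyap_op N A ^^ m) (mat 1) *v c) \<le> (1/2) * (norm c)\<^sup>2"
    and "0 < m"
  obtains P where "\<And>x. (norm x)\<^sup>2 \<le> x \<bullet> (P *v x)"
    and "\<And>x. x \<bullet> (lyap_op N A P *v x) \<le> x \<bullet> (P *v x) - (1/2) * (norm x)\<^sup>2"
proof
  let ?G = "\<lambda>k. (lyap_op N A ^^ k) (mat 1)"
  define P where "P = (\<Sum>k<m. ?G k)"
  have P: "x \<bullet> (P *v y) = (\<Sum>k<m. x \<bullet> (?G k *v y))" for x y
    by (simp add: P_def matrix_vector_mult_sum_left inner_sum_right)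
  show "(norm x)\<^sup>2 \<le> x \<bullet> (P *v x)" for x :: "real^'n"
  proof -
    \<comment> \<open>The summand for power 0 is the identity and the others are nonnegative;
      \<open>0 < m\<close> ensures that it is present.\<close>
    have "(norm x)\<^sup>2 = x \<bullet> (?G 0 *v x)" by (simp add: power2_norm_eq_inner)
    also have "\<dots> \<le> (\<Sum>k<m. x \<bullet> (?G k *v x))"
      using \<open>0 < m\<close> by (intro member_le_sum) (auto intro: lyap_op_pow_nonneg)
    finally show ?thesis by (simp add: P)
  qed
  show "x \<bullet> (lyap_op N A P *v x) \<le> x \<bullet> (P *v x) - (1/2) * (norm x)\<^sup>2" for x :: "real^'n"
  proof -
    have "x \<bullet> (lyap_op N A P *v x) = (\<Sum>k<m. x \<bullet> (?G (Suc k) *v x))"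
      by (simp add: inner_lyap_op P) (rule sum.swap)
    also have "\<dots> = x \<bullet> (P *v x) + (x \<bullet> (?G m *v x) - x \<bullet> (?G 0 *v x))"
      using sum_lessThan_telescope[of "\<lambda>k. x \<bullet> (?G k *v x)" m]
      by (simp only: P sum_subtractf)
    finally show ?thesis using assms(1)[of x] by (simp add: power2_norm_eq_inner)
  qed
qed

section \<open>Independence and square integrability\<close>

text \<open>Every preimage under \<open>f \<circ> X\<close> is already a preimage under
  \<open>X\<close>, so independence is inherited. The composed variables share a value type, which
  gives access to \<open>indep_var\<close>.\<close>

lemma indep_rv_compose:
  assumes "prob_space M" and XY: "indep_rv M S X T Y"
    and f: "f \<in> measurable S S'" and h: "h \<in> measurable T T'"
  shows "prob_space.indep_var M S' (\<lambda>\<omega>. f (X \<omega>)) T' (\<lambda>\<omega>. h (Y \<omega>))"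
proof -
  interpret prob_space M by fact
  have X: "X \<in> measurable M S" and Y: "Y \<in> measurable M T"
    and ind: "indep_set {X -` B \<inter> space M |B. B \<in> sets S} {Y -` C \<inter> space M |C. C \<in> sets T}"
    using XY by (auto simp: indep_rv_def)
  have sub: "sigma_sets (space M) {(\<lambda>\<omega>. f (X \<omega>)) -` B \<inter> space M |B. B \<in> sets S'}
      \<subseteq> {X -` B \<inter> space M |B. B \<in> sets S}"
    if f: "f \<in> measurable S S'" and X: "X \<in> measurable M S" for f X and S :: "'x measure" and S' :: "'y measure"
  proof -
    \<comment> \<open>Preimages of a sigma-algebra form a sigma-algebra, so closing the smaller
      family under \<open>sigma_sets\<close> does not leave it.\<close>
    have "sigma_algebra (space M) {X -` B \<inter> space M |B. B \<in> sets S}"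
      using sets.sigma_algebra_axioms[of "vimage_algebra (space M) X S"]
        sets_vimage_algebra2[of X "space M" S] X by (auto simp: measurable_def)
    moreover have "{(\<lambda>\<omega>. f (X \<omega>)) -` B \<inter> space M |B. B \<in> sets S'} \<subseteq> {X -` B \<inter> space M |B. B \<in> sets S}"
    proof safe
      fix B assume "B \<in> sets S'"
      then have "f -` B \<inter> space S \<in> sets S" using f by measurable
      moreover have "(\<lambda>\<omega>. f (X \<omega>)) -` B \<inter> space M = X -` (f -` B \<inter> space S) \<inter> space M"
        using X by (auto simp: measurable_def)
      ultimately show "\<exists>B'. (\<lambda>\<omega>. f (X \<omega>)) -` B \<inter> space M = X -` B' \<inter> space M \<and> B' \<in> sets S"
        by blast
    qed
    ultimately show ?thesis by (rule sigma_algebra.sigma_sets_subset)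
  qed
  have "indep_set (sigma_sets (space M) {(\<lambda>\<omega>. f (X \<omega>)) -` B \<inter> space M |B. B \<in> sets S'})
      (sigma_sets (space M) {(\<lambda>\<omega>. h (Y \<omega>)) -` B \<inter> space M |B. B \<in> sets T'})"
    using ind unfolding indep_set_def
    by (rule indep_sets_mono_sets) (use sub[OF f X] sub[OF h Y] in \<open>auto split: bool.split\<close>)
  then show ?thesis
    unfolding indep_var_eq using X Y f h by (auto intro: measurable_compose)
qed

definition square_integrable_rv :: "'w measure \<Rightarrow> ('w \<Rightarrow> 'b::euclidean_space) \<Rightarrow> bool" where
  "square_integrable_rv M X \<longleftrightarrow> X \<in> borel_measurable M \<and> integrable M (\<lambda>\<omega>. (norm (X \<omega>))\<^sup>2)"

text \<open>The integrand is dominated by a multiple of \<open>|X|^2 + |Y|^2\<close>, since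
  \<open>2ab \<le> a^2 + b^2\<close>.\<close>

lemma square_integrable_bilinear:
  fixes G :: "real^'n^'n"
  assumes "square_integrable_rv M X" "square_integrable_rv M Y"
  shows "integrable M (\<lambda>\<omega>. X \<omega> \<bullet> (G *v Y \<omega>))"
proof -
  obtain C where C: "0 < C" "\<And>x y. \<bar>x \<bullet> (G *v y)\<bar> \<le> C * (norm x * norm y)"
    using matrix_bilinear_bound[of G] by blast
  have [measurable]: "X \<in> borel_measurable M" "Y \<in> borel_measurable M"
    using assms by (auto simp: square_integrable_rv_def)
  show ?thesis
  proof (rule Bochner_Integration.integrable_bound)
    show "integrable M (\<lambda>\<omega>. C * ((norm (X \<omega>))\<^sup>2 + (norm (Y \<omega>))\<^sup>2))"
      using assms by (auto simp: square_integrable_rv_def)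
    show "AE \<omega> in M. norm (X \<omega> \<bullet> (G *v Y \<omega>)) \<le> norm (C * ((norm (X \<omega>))\<^sup>2 + (norm (Y \<omega>))\<^sup>2))"
    proof (rule AE_I2)
      fix \<omega>
      have "norm (X \<omega>) * norm (Y \<omega>) \<le> (norm (X \<omega>))\<^sup>2 + (norm (Y \<omega>))\<^sup>2"
        using sum_squares_bound[of "norm (X \<omega>)" "norm (Y \<omega>)"]
          mult_nonneg_nonneg[OF norm_ge_zero[of "X \<omega>"] norm_ge_zero[of "Y \<omega>"]] by linarith
      then have "C * (norm (X \<omega>) * norm (Y \<omega>)) \<le> C * ((norm (X \<omega>))\<^sup>2 + (norm (Y \<omega>))\<^sup>2)"
        using C(1) by (intro mult_left_mono) auto
      then show "norm (X \<omega> \<bullet> (G *v Y \<omega>)) \<le> norm (C * ((norm (X \<omega>))\<^sup>2 + (norm (Y \<omega>))\<^sup>2))"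
        using C(2)[of "X \<omega>" "Y \<omega>"] by simp
    qed
  qed measurable
qed

section \<open>One step of the second moment\<close>

definition gain :: "(nat \<Rightarrow> nat \<Rightarrow> 'w \<Rightarrow> real) \<Rightarrow> nat \<Rightarrow> nat \<Rightarrow> 'w \<Rightarrow> real" where
  "gain \<nu> k i \<omega> = (if i = 0 then 1 else \<nu> i k \<omega>)"

text \<open>The update \<open>\<tau>(0 := 0)\<close> gives the drift \<open>A 0\<close> delay zero
  whatever \<open>\<tau> 0\<close> is, so that all N + 1 terms have one form.\<close>

lemma delay_state_gain:
  "delay_state N A \<nu> \<tau> \<phi> (int k + 1) \<omega> =
    (\<Sum>i = 0..N. gain \<nu> k i \<omega> *\<^sub>R
      (A i *v delay_state N A \<nu> \<tau> \<phi> (int k - int ((\<tau>(0 := 0)) i)) \<omega>))"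
  unfolding delay_state_step
  by (subst sum.atLeast_Suc_atMost) (auto simp: gain_def intro!: sum.cong)

text \<open>Exactly one index 0 brings in the mean, equal positive indices the variance, and
  distinct positive indices the mutual independence of the noises.\<close>

lemma gain_product:
  assumes "prob_space M" "zero_mean_unit_variance M N \<nu>"
    and "prob_space.indep_vars M (\<lambda>_. borel) (\<lambda>i. \<nu> i k) {1..N}"
    and "i \<in> {0..N}" "j \<in> {0..N}"
  shows "integrable M (\<lambda>\<omega>. gain \<nu> k i \<omega> * gain \<nu> k j \<omega>)"
    and "(\<integral>\<omega>. gain \<nu> k i \<omega> * gain \<nu> k j \<omega> \<partial>M) = (if i = j then 1 else 0)"
proof -
  interpret prob_space M by fact
  have \<nu>: "\<nu> i k \<in> borel_measurable M" "integrable M (\<lambda>\<omega>. (\<nu> i k \<omega>)\<^sup>2)"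
    "integrable M (\<nu> i k)" "expectation (\<nu> i k) = 0" "expectation (\<lambda>\<omega>. (\<nu> i k \<omega>)\<^sup>2) = 1"
    if "i \<in> {1..N}" for i
  proof -
    show *: "\<nu> i k \<in> borel_measurable M" "integrable M (\<lambda>\<omega>. (\<nu> i k \<omega>)\<^sup>2)" "expectation (\<nu> i k) = 0"
      using assms(2) that by (auto simp: zero_mean_unit_variance_def)
    then show "integrable M (\<nu> i k)" using square_integrable_imp_integrable by auto
    have "variance (\<nu> i k) = 1"
      using assms(2) that unfolding zero_mean_unit_variance_def by blast
    then show "expectation (\<lambda>\<omega>. (\<nu> i k \<omega>)\<^sup>2) = 1" by (simp add: *)
  qed
  have "integrable M (\<lambda>\<omega>. gain \<nu> k i \<omega> * gain \<nu> k j \<omega>) \<and>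
    (\<integral>\<omega>. gain \<nu> k i \<omega> * gain \<nu> k j \<omega> \<partial>M) = (if i = j then 1 else 0)"
  proof (cases "i = 0 \<or> j = 0 \<or> i = j")
    case True
    then show ?thesis
      using \<nu>[of i] \<nu>[of j] assms(4,5) by (cases "i = 0"; cases "j = 0")
        (auto simp: gain_def power2_eq_square prob_space)
  next
    case False
    then have ij: "i \<in> {1..N}" "j \<in> {1..N}" "i \<noteq> j" using assms(4,5) by auto
    have iv: "indep_vars (\<lambda>_. borel) (\<lambda>i. \<nu> i k) {i, j}"
      using assms(3) by (rule indep_vars_subset) (use ij in auto)
    have "integrable M (\<lambda>\<omega>. \<Prod>l\<in>{i, j}. \<nu> l k \<omega>)"
      by (rule indep_vars_integrable[OF _ iv]) (use ij \<nu>(3) in auto)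
    moreover have "(\<integral>\<omega>. (\<Prod>l\<in>{i, j}. \<nu> l k \<omega>) \<partial>M) = (\<Prod>l\<in>{i, j}. expectation (\<nu> l k))"
      by (rule indep_vars_lebesgue_integral[OF _ iv]) (use ij \<nu>(3) in auto)
    ultimately show ?thesis
      using \<nu>(4)[OF ij(1)] ij by (simp add: gain_def)
  qed
  then show "integrable M (\<lambda>\<omega>. gain \<nu> k i \<omega> * gain \<nu> k j \<omega>)"
    and "(\<integral>\<omega>. gain \<nu> k i \<omega> * gain \<nu> k j \<omega> \<partial>M) = (if i = j then 1 else 0)" by auto
qed

lemma delay_le_max_delay: "i \<in> {0..N} \<Longrightarrow> (\<tau>(0 := 0)) i \<le> max_delay N \<tau>"
  by (auto simp: max_delay_def)

text \<open>Since \<open>indep_rv\<close> includes measurability of the whole segment, no induction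
  along the recursion is required.\<close>

lemma noise_state_indep_measurable:
  assumes "noise_state_indep M N A \<nu> \<tau> \<phi>" and "s \<in> {int k - int (max_delay N \<tau>)..int k}"
  shows "delay_state N A \<nu> \<tau> \<phi> s \<in> borel_measurable M"
proof -
  let ?I = "{int k - int (max_delay N \<tau>)..int k}"
  have "(\<lambda>\<omega>. \<lambda>s\<in>?I. delay_state N A \<nu> \<tau> \<phi> s \<omega>) \<in> measurable M (Pi\<^sub>M ?I (\<lambda>_. borel))"
    using assms(1) by (auto simp: noise_state_indep_def indep_rv_def)
  then have "(\<lambda>\<omega>. (\<lambda>s\<in>?I. delay_state N A \<nu> \<tau> \<phi> s \<omega>) s) \<in> borel_measurable M"
    by (rule measurable_compose) (use assms(2) in measurable)
  then show ?thesis using assms(2) by simp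
qed

text \<open>Expanding the form gives products of two gains with a bilinear form of two delayed
  states. These states lie in the segment at time k, which is independent of the noises at time k,
  so expectations factor and orthonormality of the gains leaves only the diagonal. Correlations
  between states at different times thus never enter.\<close>

lemma second_moment_step:
  fixes N and A :: "nat \<Rightarrow> real^'n^'n" and G :: "real^'n^'n" and \<nu> \<tau> \<phi>
  defines "x \<equiv> delay_state N A \<nu> \<tau> \<phi>"
  assumes "prob_space M" "zero_mean_unit_variance M N \<nu>"
    and nsi: "noise_state_indep M N A \<nu> \<tau> \<phi>"
    and sq: "\<And>i. i \<in> {0..N} \<Longrightarrow> square_integrable_rv M (x (int k - int ((\<tau>(0 := 0)) i)))"
  shows "square_integrable_rv M (x (int k + 1))"
    and "(\<integral>\<omega>. x (int k + 1) \<omega> \<bullet> (G *v x (int k + 1) \<omega>) \<partial>M) =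
      (\<Sum>i = 0..N. \<integral>\<omega>. (A i *v x (int k - int ((\<tau>(0 := 0)) i)) \<omega>) \<bullet>
        (G *v (A i *v x (int k - int ((\<tau>(0 := 0)) i)) \<omega>)) \<partial>M)"
proof -
  interpret prob_space M by fact
  define y where "y i = x (int k - int ((\<tau>(0 := 0)) i))" for i
  let ?I = "{int k - int (max_delay N \<tau>)..int k}"
  have sq: "square_integrable_rv M (y i)" if "i \<in> {0..N}" for i
    using sq[OF that] by (simp add: y_def)
  have in_I: "int k - int ((\<tau>(0 := 0)) i) \<in> ?I" if "i \<in> {0..N}" for i
    using delay_le_max_delay[OF that, of \<tau>] by simp
  have iv: "indep_vars (\<lambda>_. borel) (\<lambda>i. \<nu> i k) {1..N}"
    and ir: "indep_rv M (Pi\<^sub>M {1..N} (\<lambda>_. borel)) (\<lambda>\<omega>. \<lambda>i\<in>{1..N}. \<nu> i k \<omega>)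
      (Pi\<^sub>M ?I (\<lambda>_. borel)) (\<lambda>\<omega>. \<lambda>s\<in>?I. x s \<omega>)"
    using nsi by (auto simp: noise_state_indep_def x_def)
  note gp = gain_product[OF \<open>prob_space M\<close> assms(3) iv]
  \<comment> \<open>Quantified over \<open>G\<close>: \<open>mat 1\<close> gives square
    integrability of the next state, the given \<open>G\<close> the moment identity.\<close>
  have prod: "integrable M (\<lambda>\<omega>. (gain \<nu> k i \<omega> * gain \<nu> k j \<omega>) * ((A i *v y i \<omega>) \<bullet> (G *v (A j *v y j \<omega>))))
      \<and> (\<integral>\<omega>. (gain \<nu> k i \<omega> * gain \<nu> k j \<omega>) * ((A i *v y i \<omega>) \<bullet> (G *v (A j *v y j \<omega>))) \<partial>M) =
        (if i = j then \<integral>\<omega>. (A i *v y i \<omega>) \<bullet> (G *v (A i *v y i \<omega>)) \<partial>M else 0)"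
    if i: "i \<in> {0..N}" and j: "j \<in> {0..N}" for i j and G :: "real^'n^'n"
  proof -
    \<comment> \<open>\<open>f\<close> and \<open>h\<close> read the gain product off the noise
      vector and the bilinear form off the state segment, the shape required by
      \<open>indep_rv_compose\<close>.\<close>
    define f where "f p = (if i = 0 then 1 else p i) * (if j = 0 then 1 else p j)" for p :: "nat \<Rightarrow> real"
    define h where "h p = (A i *v p (int k - int ((\<tau>(0 := 0)) i))) \<bullet>
      (G *v (A j *v p (int k - int ((\<tau>(0 := 0)) j))))" for p :: "int \<Rightarrow> real^'n"
    have comp: "(\<lambda>p. if l = 0 then 1 else p l) \<in> borel_measurable (Pi\<^sub>M {1..N} (\<lambda>_. borel))"
      if "l \<in> {0..N}" for l :: nat
      using that by (cases "l = 0") auto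
    have "f \<in> borel_measurable (Pi\<^sub>M {1..N} (\<lambda>_. borel))"
      unfolding f_def by (intro borel_measurable_times comp i j)
    moreover have "h \<in> borel_measurable (Pi\<^sub>M ?I (\<lambda>_. borel))"
      unfolding h_def by (intro borel_measurable_inner borel_measurable_matrix_vector_mult
          measurable_component_singleton in_I i j)
    ultimately have "indep_var borel (\<lambda>\<omega>. f (\<lambda>i\<in>{1..N}. \<nu> i k \<omega>)) borel (\<lambda>\<omega>. h (\<lambda>s\<in>?I. x s \<omega>))"
      by (rule indep_rv_compose[OF \<open>prob_space M\<close> ir])
    moreover have "(\<lambda>\<omega>. f (\<lambda>i\<in>{1..N}. \<nu> i k \<omega>)) = (\<lambda>\<omega>. gain \<nu> k i \<omega> * gain \<nu> k j \<omega>)"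
      using i j by (auto simp: f_def gain_def)
    moreover have "(\<lambda>\<omega>. h (\<lambda>s\<in>?I. x s \<omega>)) = (\<lambda>\<omega>. (A i *v y i \<omega>) \<bullet> (G *v (A j *v y j \<omega>)))"
      by (simp only: h_def y_def restrict_apply' in_I[OF i] in_I[OF j])
    ultimately have "indep_var borel (\<lambda>\<omega>. gain \<nu> k i \<omega> * gain \<nu> k j \<omega>)
        borel (\<lambda>\<omega>. (A i *v y i \<omega>) \<bullet> (G *v (A j *v y j \<omega>)))" by simp
    moreover have "integrable M (\<lambda>\<omega>. (A i *v y i \<omega>) \<bullet> (G *v (A j *v y j \<omega>)))"
      using square_integrable_bilinear[OF sq[OF i] sq[OF j], of "transpose (A i) ** G ** A j"]
      by (simp add: inner_matrix_congruence)
    ultimately show ?thesis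
      using gp[OF i j] indep_var_integrable[of "\<lambda>\<omega>. gain \<nu> k i \<omega> * gain \<nu> k j \<omega>"]
        indep_var_lebesgue_integral[of "\<lambda>\<omega>. gain \<nu> k i \<omega> * gain \<nu> k j \<omega>"] by simp
  qed
  have expand: "x (int k + 1) \<omega> \<bullet> (G *v x (int k + 1) \<omega>) =
    (\<Sum>i = 0..N. \<Sum>j = 0..N. (gain \<nu> k i \<omega> * gain \<nu> k j \<omega>) *
      ((A i *v y i \<omega>) \<bullet> (G *v (A j *v y j \<omega>))))" for \<omega> and G :: "real^'n^'n"
  proof -
    have "x (int k + 1) \<omega> = (\<Sum>i = 0..N. gain \<nu> k i \<omega> *\<^sub>R (A i *v y i \<omega>))"
      unfolding x_def y_def by (rule delay_state_gain)
    then show ?thesis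
      by (simp only: linear_sum[OF matrix_vector_mul_linear], subst inner_sum_left)
        (simp add: inner_sum_right matrix_vector_mult_scaleR mult_ac)
  qed
  have "integrable M (\<lambda>\<omega>. x (int k + 1) \<omega> \<bullet> (mat 1 *v x (int k + 1) \<omega>))"
    unfolding expand by (intro Bochner_Integration.integrable_sum prod[THEN conjunct1])
  \<comment> \<open>The next state is the last entry of the segment at time
    \<open>Suc k\<close>.\<close>
  moreover have "x (int k + 1) \<in> borel_measurable M"
    using noise_state_indep_measurable[OF nsi, of "int k + 1" "Suc k"] by (simp add: x_def)
  ultimately show "square_integrable_rv M (x (int k + 1))"
    by (simp add: square_integrable_rv_def power2_norm_eq_inner)
  have "(\<integral>\<omega>. x (int k + 1) \<omega> \<bullet> (G *v x (int k + 1) \<omega>) \<partial>M) =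
      (\<Sum>i = 0..N. \<integral>\<omega>. (\<Sum>j = 0..N. (gain \<nu> k i \<omega> * gain \<nu> k j \<omega>) *
        ((A i *v y i \<omega>) \<bullet> (G *v (A j *v y j \<omega>)))) \<partial>M)"
    unfolding expand
    by (intro Bochner_Integration.integral_sum Bochner_Integration.integrable_sum prod[THEN conjunct1])
  also have "\<dots> = (\<Sum>i = 0..N. \<Sum>j = 0..N. \<integral>\<omega>. (gain \<nu> k i \<omega> * gain \<nu> k j \<omega>) *
        ((A i *v y i \<omega>) \<bullet> (G *v (A j *v y j \<omega>))) \<partial>M)"
    by (intro sum.cong refl Bochner_Integration.integral_sum prod[THEN conjunct1])
  also have "\<dots> = (\<Sum>i = 0..N. \<Sum>j = 0..N.
        if i = j then \<integral>\<omega>. (A i *v y i \<omega>) \<bullet> (G *v (A i *v y i \<omega>)) \<partial>M else 0)"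
    by (intro sum.cong refl prod[THEN conjunct2])
  also have "\<dots> = (\<Sum>i = 0..N. \<integral>\<omega>. (A i *v y i \<omega>) \<bullet> (G *v (A i *v y i \<omega>)) \<partial>M)"
    by simp
  finally show "(\<integral>\<omega>. x (int k + 1) \<omega> \<bullet> (G *v x (int k + 1) \<omega>) \<partial>M) =
      (\<Sum>i = 0..N. \<integral>\<omega>. (A i *v x (int k - int ((\<tau>(0 := 0)) i)) \<omega>) \<bullet>
        (G *v (A i *v x (int k - int ((\<tau>(0 := 0)) i)) \<omega>)) \<partial>M)"
    unfolding y_def .
qed

section \<open>Decay of a scalar delayed recursion\<close>

text \<open>Lyapunov-Krasovskii argument in scalar form: \<open>V\<close> plus the weighted content
  of the delay lines shrinks by \<rho> per step. Of the factor \<open>\<rho> ^ Suc T\<close> in the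
  dissipation, \<open>T\<close> powers pay for the largest weight at which a term enters a line, and
  the last one is the decay.\<close>

lemma delayed_sum_decay:
  fixes q :: "nat \<Rightarrow> int \<Rightarrow> real" and V :: "int \<Rightarrow> real" and \<sigma> :: "nat \<Rightarrow> nat"
  assumes \<rho>: "0 < \<rho>" "\<rho> \<le> 1"
    and \<sigma>: "\<And>i. i \<in> I \<Longrightarrow> \<sigma> i \<le> T"
    and step: "\<And>k::nat. V (int k + 1) = (\<Sum>i\<in>I. q i (int k - int (\<sigma> i)))"
    and dis: "\<And>k::nat. (\<Sum>i\<in>I. q i (int k)) \<le> \<rho> ^ Suc T * V (int k)"
    and nonneg: "\<And>i s. i \<in> I \<Longrightarrow> - int T \<le> s \<Longrightarrow> 0 \<le> q i s"
  shows "V (int k) \<le> \<rho> ^ k * (V 0 + (\<Sum>i\<in>I. \<Sum>d = 1..\<sigma> i. (1/\<rho>) ^ (Suc (\<sigma> i) - d) * q i (- int d)))"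
proof -
  txt \<open>The weights make the term leaving delay line \<open>i\<close> have weight 1, while ageing costs a factor \<open>\<rho>\<close>.\<close>
  define F where "F i k = (\<Sum>d = 1..\<sigma> i. (1/\<rho>) ^ (Suc (\<sigma> i) - d) * q i (int k - int d))" for i k
  have F_step: "F i (Suc k) + q i (int k - int (\<sigma> i)) = (1/\<rho>) ^ \<sigma> i * q i (int k) + \<rho> * F i k" for i k
  proof -
    \<comment> \<open>The leaving term is the summand \<open>d = Suc (\<sigma> i)\<close>, whose
      weight is 1; the shift of \<open>d\<close> then puts the fresh term \<open>q i (int k)\<close>
      at \<open>d = 0\<close>.\<close>
    have "F i (Suc k) + q i (int k - int (\<sigma> i)) =
        (\<Sum>d = Suc 0..Suc (\<sigma> i). (1/\<rho>) ^ (Suc (\<sigma> i) - d) * q i (int (Suc k) - int d))"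
      by (simp add: F_def)
    also have "\<dots> = (\<Sum>d = 0..\<sigma> i. (1/\<rho>) ^ (\<sigma> i - d) * q i (int k - int d))"
      by (subst sum.shift_bounds_cl_Suc_ivl) simp
    also have "\<dots> = (1/\<rho>) ^ \<sigma> i * q i (int k) + (\<Sum>d = 1..\<sigma> i. (1/\<rho>) ^ (\<sigma> i - d) * q i (int k - int d))"
      by (subst sum.atLeast_Suc_atMost) auto
    also have "(\<Sum>d = 1..\<sigma> i. (1/\<rho>) ^ (\<sigma> i - d) * q i (int k - int d)) = \<rho> * F i k"
      unfolding F_def sum_distrib_left using \<rho>(1) by (intro sum.cong) (auto simp: Suc_diff_le)
    finally show ?thesis .
  qed
  define W where "W k = V (int k) + (\<Sum>i\<in>I. F i k)" for k
  have W_step: "W (Suc k) \<le> \<rho> * W k" for k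
  proof -
    \<comment> \<open>By the recursion, \<open>V (int (Suc k))\<close> is exactly the total leaving
      the delay lines.\<close>
    have "W (Suc k) = (\<Sum>i\<in>I. F i (Suc k) + q i (int k - int (\<sigma> i)))"
      using step[of k] by (simp add: W_def sum.distrib add.commute)
    also have "\<dots> = (\<Sum>i\<in>I. (1/\<rho>) ^ \<sigma> i * q i (int k)) + \<rho> * (\<Sum>i\<in>I. F i k)"
      by (simp add: F_step sum.distrib sum_distrib_left)
    also have "(\<Sum>i\<in>I. (1/\<rho>) ^ \<sigma> i * q i (int k)) \<le> (1/\<rho>) ^ T * (\<Sum>i\<in>I. q i (int k))"
      unfolding sum_distrib_left using \<rho> \<sigma> nonneg
      by (intro sum_mono mult_right_mono power_increasing) auto
    also have "\<dots> \<le> (1/\<rho>) ^ T * (\<rho> ^ Suc T * V (int k))"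
      using \<rho> by (intro mult_left_mono dis) auto
    also have "\<dots> = \<rho> * V (int k)" using \<rho> by (simp add: power_one_over)
    finally show ?thesis by (simp add: W_def algebra_simps)
  qed
  have "V (int k) \<le> W k"
    unfolding W_def F_def using \<sigma> \<rho>
    by (force intro!: sum_nonneg mult_nonneg_nonneg nonneg)
  also have "W k \<le> \<rho> ^ k * W 0"
  proof (induction k)
    case (Suc k)
    show ?case using W_step[of k] mult_left_mono[OF Suc less_imp_le[OF \<rho>(1)]]
      by (simp only: power_Suc mult.assoc)
  qed simp
  finally show ?thesis by (simp add: W_def F_def)
qed

section \<open>Zero delays: from stability to a contraction\<close>

text \<open>Each step replaces \<open>G\<close> by \<open>lyap_op N A G\<close>, so the induction
  runs over all \<open>G\<close>; square integrability is carried along because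
  \<open>second_moment_step\<close> requires it.\<close>

lemma zero_delay_second_moment:
  fixes A :: "nat \<Rightarrow> real^'n^'n" and c :: "real^'n"
  assumes "prob_space M" "zero_mean_unit_variance M N \<nu>"
    and "noise_state_indep M N A \<nu> (\<lambda>_. 0) (\<lambda>s \<omega>. c)"
  shows "square_integrable_rv M (delay_state N A \<nu> (\<lambda>_. 0) (\<lambda>s \<omega>. c) (int k)) \<and>
    (\<integral>\<omega>. delay_state N A \<nu> (\<lambda>_. 0) (\<lambda>s \<omega>. c) (int k) \<omega> \<bullet>
      (G *v delay_state N A \<nu> (\<lambda>_. 0) (\<lambda>s \<omega>. c) (int k) \<omega>) \<partial>M) = c \<bullet> ((lyap_op N A ^^ k) G *v c)"
proof -
  interpret prob_space M by fact
  let ?x = "delay_state N A \<nu> (\<lambda>_. 0) (\<lambda>s \<omega>. c)"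
  have zero: "(\<lambda>_. 0)(0 := 0) = (\<lambda>_::nat. 0::nat)" by auto
  show "square_integrable_rv M (?x (int k)) \<and>
    (\<integral>\<omega>. ?x (int k) \<omega> \<bullet> (G *v ?x (int k) \<omega>) \<partial>M) = c \<bullet> ((lyap_op N A ^^ k) G *v c)"
  proof (induction k arbitrary: G)
    case 0
    have "?x 0 = (\<lambda>_. c)" by (auto simp: delay_state_init)
    then show ?case by (simp add: square_integrable_rv_def prob_space)
  next
    case (Suc k)
    have sq: "square_integrable_rv M (?x (int k))" using Suc by blast
    have "square_integrable_rv M (?x (int k + 1))"
      by (rule second_moment_step[OF assms]) (use sq in \<open>simp add: zero\<close>)
    moreover have "(\<integral>\<omega>. ?x (int k + 1) \<omega> \<bullet> (G *v ?x (int k + 1) \<omega>) \<partial>M) =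
        (\<Sum>i = 0..N. \<integral>\<omega>. (A i *v ?x (int k) \<omega>) \<bullet> (G *v (A i *v ?x (int k) \<omega>)) \<partial>M)"
      by (subst second_moment_step(2)[OF assms]) (use sq in \<open>simp_all add: zero\<close>)
    moreover have "\<dots> = (\<integral>\<omega>. ?x (int k) \<omega> \<bullet> (lyap_op N A G *v ?x (int k) \<omega>) \<partial>M)"
      unfolding inner_lyap_op
      by (subst Bochner_Integration.integral_sum)
        (auto simp: inner_matrix_congruence intro!: square_integrable_bilinear sq)
    ultimately show ?case
      using Suc.IH[of "lyap_op N A G"] by (simp add: funpow_swap1 add.commute)
  qed
qed

text \<open>From a deterministic initial value the second moments are the quadratic forms of
  \<open>L^k(1)\<close>, so the exponential bound passes to these matrices.\<close>

lemma zero_delay_contraction: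
  fixes A :: "nat \<Rightarrow> real^'n^'n"
  assumes "prob_space M" "zero_mean_unit_variance M N \<nu>"
    and nsi: "\<And>c::real^'n. noise_state_indep M N A \<nu> (\<lambda>_. 0) (\<lambda>s \<omega>. c)"
    and stable: "ms_exp_stable M N A \<nu> (\<lambda>_. 0)"
  obtains m where "0 < m" "\<And>c. c \<bullet> ((lyap_op N A ^^ m) (mat 1) *v c) \<le> (1/2) * (norm c)\<^sup>2"
proof -
  interpret prob_space M by fact
  let ?x = "\<lambda>c. delay_state N A \<nu> (\<lambda>_. 0) (\<lambda>s \<omega>. c)"
  \<comment> \<open>The only initial time is 0, so the maximum in the stability bound becomes
    \<open>(norm c)\<^sup>2\<close>.\<close>
  have it: "init_times N (\<lambda>_. 0) = {0}" by (simp add: init_times_def max_delay_def image_constant_conv)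
  obtain \<rho> \<beta> where \<rho>: "0 < \<rho>" "\<rho> < 1" "1 < \<beta>"
    and bound: "\<And>\<phi> k. (\<forall>s\<in>init_times N (\<lambda>_. 0). \<phi> s \<in> borel_measurable M) \<Longrightarrow>
      noise_state_indep M N A \<nu> (\<lambda>_. 0) \<phi> \<Longrightarrow>
      (\<integral>\<^sup>+\<omega>. ennreal ((norm (delay_state N A \<nu> (\<lambda>_. 0) \<phi> (int k) \<omega>))\<^sup>2) \<partial>M)
        \<le> ennreal (\<beta> * \<rho> ^ k) * (\<integral>\<^sup>+\<omega>. ennreal (MAX s\<in>init_times N (\<lambda>_. 0). (norm (\<phi> s \<omega>))\<^sup>2) \<partial>M)"
    using stable unfolding ms_exp_stable_def by blast
  have mom: "c \<bullet> ((lyap_op N A ^^ k) (mat 1) *v c) \<le> \<beta> * \<rho> ^ k * (norm c)\<^sup>2" for c :: "real^'n" and k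
  proof -
    note zd = zero_delay_second_moment[OF assms(1,2) nsi[of c], of k "mat 1"]
    have "ennreal (c \<bullet> ((lyap_op N A ^^ k) (mat 1) *v c)) = (\<integral>\<^sup>+\<omega>. ennreal ((norm (?x c (int k) \<omega>))\<^sup>2) \<partial>M)"
      using zd by (subst nn_integral_eq_integral) (auto simp: square_integrable_rv_def power2_norm_eq_inner)
    also have "\<dots> \<le> ennreal (\<beta> * \<rho> ^ k) * (\<integral>\<^sup>+\<omega>. ennreal (MAX s\<in>init_times N (\<lambda>_. 0). (norm c)\<^sup>2) \<partial>M)"
      by (rule bound) (use nsi in auto)
    also have "\<dots> = ennreal (\<beta> * \<rho> ^ k * (norm c)\<^sup>2)"
      using \<rho> by (simp add: it emeasure_space_1 ennreal_mult)
    finally show ?thesis using \<rho> by (subst (asm) ennreal_le_iff) auto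
  qed
  \<comment> \<open>The threshold makes \<open>\<beta> * \<rho> ^ m0\<close> less than one half;
    passing to \<open>Suc m0\<close> secures the positive exponent that
    \<open>lyapunov_matrix\<close> requires.\<close>
  obtain m0 where m0: "\<rho> ^ m0 < 1 / (2 * \<beta>)"
    using real_arch_pow_inv[of "1 / (2 * \<beta>)" \<rho>] \<rho> by auto
  have "\<rho> ^ Suc m0 \<le> \<rho> ^ m0" using \<rho> by (intro power_decreasing) auto
  then have "\<rho> ^ Suc m0 \<le> 1 / (2 * \<beta>)" using m0 by linarith
  then have "\<beta> * \<rho> ^ Suc m0 \<le> 1/2" using \<rho> by (simp add: field_simps del: power_Suc)
  then have "c \<bullet> ((lyap_op N A ^^ Suc m0) (mat 1) *v c) \<le> (1/2) * (norm c)\<^sup>2" for c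
    using mom[of c "Suc m0"] mult_right_mono[of "\<beta> * \<rho> ^ Suc m0" "1/2" "(norm c)\<^sup>2"] by fastforce
  then show thesis using that by blast
qed

section \<open>Arbitrary delays: stability from a Lyapunov matrix\<close>

text \<open>The matrix inequality compares terms at one time, whereas the recursion collects them
  from different times; \<open>delayed_sum_decay\<close> bridges the gap. Both stability constants
  are fixed before the initial condition.\<close>

lemma ms_exp_stable_of_lyapunov:
  fixes A :: "nat \<Rightarrow> real^'n^'n" and P :: "real^'n^'n"
  assumes "prob_space M" "zero_mean_unit_variance M N \<nu>"
    and P_ge: "\<And>x. (norm x)\<^sup>2 \<le> x \<bullet> (P *v x)"
    and P_dec: "\<And>x. x \<bullet> (lyap_op N A P *v x) \<le> x \<bullet> (P *v x) - (1/2) * (norm x)\<^sup>2"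
  shows "ms_exp_stable M N A \<nu> \<tau>"
proof -
  interpret prob_space M by fact
  define \<sigma> where "\<sigma> = \<tau>(0 := 0)"
  define T where "T = max_delay N \<tau>"
  have \<sigma>: "\<sigma> i \<le> T" if "i \<in> {0..N}" for i
    using delay_le_max_delay[OF that] by (simp add: \<sigma>_def T_def)
  obtain C where C: "0 < C" "\<And>x y. \<bar>x \<bullet> (P *v y)\<bar> \<le> C * (norm x * norm y)"
    using matrix_bilinear_bound[of P] by blast
  \<comment> \<open>Adding 1 gives \<open>p > 1\<close>, which places \<open>1 - 1 / (2 * p)\<close>
    strictly between 0 and 1.\<close>
  define p where "p = C + 1"
  have p: "1 < p" using C by (simp add: p_def)
  have P_le: "x \<bullet> (P *v x) \<le> p * (norm x)\<^sup>2" for x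
    using C(2)[of x x] zero_le_power2[of "norm x"]
    unfolding p_def distrib_right power2_eq_square by linarith
  \<comment> \<open>Since \<open>P \<le> p\<close> as forms, losing half of the squared norm means
    losing at least the fraction \<open>1 / (2 * p)\<close> of the form \<open>P\<close>. The root
    spreads this loss over \<open>Suc T\<close> steps, as \<open>delayed_sum_decay\<close>
    expects.\<close>
  define \<rho> where "\<rho> = root (Suc T) (1 - 1 / (2 * p))"
  have e: "0 < 1 - 1 / (2 * p)" "1 - 1 / (2 * p) < 1" using p by (auto simp: field_simps)
  have \<rho>: "0 < \<rho>" "\<rho> < 1" and \<rho>_pow: "\<rho> ^ Suc T = 1 - 1 / (2 * p)"
    using e unfolding \<rho>_def by (auto simp del: power_Suc)
  \<comment> \<open>Total weight of \<open>V 0\<close> and of the initial content of the delay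
    lines; each of these terms will be at most \<open>p\<close> times the initial second
    moment.\<close>
  define K where "K = 1 + (\<Sum>i = 0..N. \<Sum>d = 1..\<sigma> i. (1/\<rho>) ^ (Suc (\<sigma> i) - d))"
  have K: "1 \<le> K" using \<rho> by (auto simp: K_def intro!: sum_nonneg)
  have Kp: "1 < K * p" using mult_right_mono[of 1 K p] K p by linarith
  have "(\<integral>\<^sup>+\<omega>. ennreal ((norm (delay_state N A \<nu> \<tau> \<phi> (int k) \<omega>))\<^sup>2) \<partial>M)
      \<le> ennreal (K * p * \<rho> ^ k) * (\<integral>\<^sup>+\<omega>. ennreal (MAX s\<in>init_times N \<tau>. (norm (\<phi> s \<omega>))\<^sup>2) \<partial>M)"
    if \<phi>: "\<forall>s\<in>init_times N \<tau>. \<phi> s \<in> borel_measurable M" and nsi: "noise_state_indep M N A \<nu> \<tau> \<phi>"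
    for \<phi> k
  proof (cases "(\<integral>\<^sup>+\<omega>. ennreal (MAX s\<in>init_times N \<tau>. (norm (\<phi> s \<omega>))\<^sup>2) \<partial>M)")
    case top
    \<comment> \<open>An infinite initial moment times a positive factor is infinite, so the bound
      is trivial.\<close>
    then show ?thesis using K p \<rho> by (simp add: ennreal_mult_top)
  next
    case (real m)
    define x where "x = delay_state N A \<nu> \<tau> \<phi>"
    have init: "square_integrable_rv M (x s) \<and> (\<integral>\<omega>. (norm (x s \<omega>))\<^sup>2 \<partial>M) \<le> m"
      if "- int T \<le> s" "s \<le> 0" for s
    proof -
      have s: "s \<in> init_times N \<tau>" using that by (simp add: init_times_def T_def)
      have xs: "x s = \<phi> s" using that by (auto simp: x_def delay_state_init)
      have meas: "\<phi> s \<in> borel_measurable M" using \<phi> s by blast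
      have le: "(\<integral>\<^sup>+\<omega>. ennreal ((norm (\<phi> s \<omega>))\<^sup>2) \<partial>M) \<le> ennreal m"
        unfolding real(2)[symmetric]
        by (intro nn_integral_mono ennreal_leI Max_ge) (use s in \<open>auto simp: init_times_def\<close>)
      then have int: "integrable M (\<lambda>\<omega>. (norm (\<phi> s \<omega>))\<^sup>2)"
        using meas by (intro integrableI_bounded) (auto simp: le_less_trans)
      then have "(\<integral>\<omega>. (norm (\<phi> s \<omega>))\<^sup>2 \<partial>M) \<le> m"
        using le real(1) by (simp add: nn_integral_eq_integral)
      then show ?thesis using int meas by (simp add: xs square_integrable_rv_def)
    qed
    \<comment> \<open>A step reaches back by up to \<open>T\<close>, so the induction carries all
      times up to k.\<close>
    have sq_upto: "\<forall>s. - int T \<le> s \<and> s \<le> int k \<longrightarrow> square_integrable_rv M (x s)" for k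
    proof (induction k)
      case 0
      then show ?case using init by simp
    next
      case (Suc k)
      have "square_integrable_rv M (x (int k + 1))"
        unfolding x_def
      proof (rule second_moment_step(1)[OF assms(1,2) nsi])
        fix i assume "i \<in> {0..N}"
        then show "square_integrable_rv M (delay_state N A \<nu> \<tau> \<phi> (int k - int ((\<tau>(0 := 0)) i)))"
          using Suc \<sigma>[of i] by (auto simp: x_def \<sigma>_def simp del: fun_upd_apply)
      qed
      then show ?case using Suc
        by (metis add.commute of_nat_Suc order_le_less zle_add1_eq_le)
    qed
    have sq: "square_integrable_rv M (x s)" if "- int T \<le> s" for s
      \<comment> \<open>For negative \<open>s\<close>, \<open>nat s\<close> is 0 and the initial
        segment is covered.\<close>
      using sq_upto[of "nat s"] that by simp
    define V where "V s = (\<integral>\<omega>. x s \<omega> \<bullet> (P *v x s \<omega>) \<partial>M)" for s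
    define q where "q i s = (\<integral>\<omega>. (A i *v x s \<omega>) \<bullet> (P *v (A i *v x s \<omega>)) \<partial>M)" for i s
    have P_nonneg: "0 \<le> y \<bullet> (P *v y)" for y
      using P_ge[of y] zero_le_power2[of "norm y"] by linarith
    have q_nonneg: "0 \<le> q i s" for i s
      unfolding q_def by (intro integral_nonneg_AE) (simp add: P_nonneg)
    have step: "V (int k + 1) = (\<Sum>i = 0..N. q i (int k - int (\<sigma> i)))" for k
      unfolding V_def q_def x_def \<sigma>_def
    proof (rule second_moment_step(2)[OF assms(1,2) nsi])
      fix i assume "i \<in> {0..N}"
      then show "square_integrable_rv M (delay_state N A \<nu> \<tau> \<phi> (int k - int ((\<tau>(0 := 0)) i)))"
        using sq \<sigma>[of i] by (auto simp: x_def \<sigma>_def simp del: fun_upd_apply)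
    qed
    have V_le: "V s \<le> p * (\<integral>\<omega>. (norm (x s \<omega>))\<^sup>2 \<partial>M)" if "- int T \<le> s" for s
    proof -
      have "V s \<le> (\<integral>\<omega>. p * (norm (x s \<omega>))\<^sup>2 \<partial>M)"
        unfolding V_def using sq[OF that]
        by (intro integral_mono square_integrable_bilinear P_le) (auto simp: square_integrable_rv_def)
      then show ?thesis by simp
    qed
    \<comment> \<open>All \<open>q i s\<close> are taken at the same time here, so they add up to
      the expected quadratic form of \<open>lyap_op N A P\<close>.\<close>
    have q_sum: "(\<Sum>i = 0..N. q i s) \<le> V s - (1/2) * (\<integral>\<omega>. (norm (x s \<omega>))\<^sup>2 \<partial>M)" if "- int T \<le> s" for s
    proof -
      note int = square_integrable_bilinear[OF sq[OF that] sq[OF that]]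
      have int2: "integrable M (\<lambda>\<omega>. (norm (x s \<omega>))\<^sup>2)" using sq[OF that] by (simp add: square_integrable_rv_def)
      have "(\<Sum>i = 0..N. q i s) = (\<integral>\<omega>. x s \<omega> \<bullet> (lyap_op N A P *v x s \<omega>) \<partial>M)"
        unfolding inner_lyap_op q_def
        by (subst Bochner_Integration.integral_sum) (auto simp: inner_matrix_congruence intro!: int)
      also have "\<dots> \<le> (\<integral>\<omega>. x s \<omega> \<bullet> (P *v x s \<omega>) - (1/2) * (norm (x s \<omega>))\<^sup>2 \<partial>M)"
        using int int2 by (intro integral_mono P_dec) auto
      also have "\<dots> = V s - (1/2) * (\<integral>\<omega>. (norm (x s \<omega>))\<^sup>2 \<partial>M)"
        unfolding V_def using int int2 by simp
      finally show ?thesis .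
    qed
    have dis: "(\<Sum>i = 0..N. q i (int k)) \<le> \<rho> ^ Suc T * V (int k)" for k
    proof -
      have "V (int k) / p \<le> (\<integral>\<omega>. (norm (x (int k) \<omega>))\<^sup>2 \<partial>M)"
        using V_le[of "int k"] p by (simp add: field_simps)
      moreover have "(1 - 1 / (2 * p)) * V (int k) = V (int k) - (1/2) * (V (int k) / p)"
        by (simp add: algebra_simps)
      moreover have "(\<Sum>i = 0..N. q i (int k)) \<le> V (int k) - (1/2) * (\<integral>\<omega>. (norm (x (int k) \<omega>))\<^sup>2 \<partial>M)"
        by (rule q_sum) simp
      ultimately show ?thesis unfolding \<rho>_pow by linarith
    qed
    have V_init: "V s \<le> p * m" if "- int T \<le> s" "s \<le> 0" for s
      by (rule order_trans[OF V_le[OF that(1)] mult_left_mono]) (use init[OF that] p in auto)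
    have q_init: "q i s \<le> p * m" if "i \<in> {0..N}" "- int T \<le> s" "s \<le> 0" for i s
    proof -
      \<comment> \<open>By nonnegativity one term is at most the sum, which the dissipation
        inequality bounds by \<open>V s\<close>.\<close>
      have "q i s \<le> (\<Sum>i = 0..N. q i s)" using that(1) q_nonneg by (intro member_le_sum) auto
      moreover have "0 \<le> (\<integral>\<omega>. (norm (x s \<omega>))\<^sup>2 \<partial>M)" by simp
      ultimately show ?thesis using q_sum[OF that(2)] V_init[OF that(2,3)] by linarith
    qed
    have "(\<integral>\<omega>. (norm (x (int k) \<omega>))\<^sup>2 \<partial>M) \<le> V (int k)"
      unfolding V_def using sq[of "int k"]
      by (intro integral_mono square_integrable_bilinear P_ge) (auto simp: square_integrable_rv_def)
    also have "\<dots> \<le> \<rho> ^ k * (V 0 + (\<Sum>i = 0..N. \<Sum>d = 1..\<sigma> i. (1/\<rho>) ^ (Suc (\<sigma> i) - d) * q i (- int d)))"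
      by (rule delayed_sum_decay[OF \<rho>(1) _ \<sigma> step dis]) (use \<rho> q_nonneg in auto)
    also have "\<dots> \<le> \<rho> ^ k * (p * m + (\<Sum>i = 0..N. \<Sum>d = 1..\<sigma> i. (1/\<rho>) ^ (Suc (\<sigma> i) - d) * (p * m)))"
    proof (intro mult_left_mono add_mono sum_mono V_init q_init)
      fix i d assume "i \<in> {0..N}" "d \<in> {1..\<sigma> i}"
      then show "- int T \<le> - int d" using \<sigma>[of i] by simp
    qed (use \<rho> in auto)
    also have "\<dots> = K * p * \<rho> ^ k * m"
      by (simp add: K_def sum_distrib_right algebra_simps flip: sum_distrib_left)
    finally have "(\<integral>\<omega>. (norm (x (int k) \<omega>))\<^sup>2 \<partial>M) \<le> K * p * \<rho> ^ k * m" .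
    then have "(\<integral>\<^sup>+\<omega>. ennreal ((norm (x (int k) \<omega>))\<^sup>2) \<partial>M) \<le> ennreal (K * p * \<rho> ^ k * m)"
      using sq[of "int k"]
      by (subst nn_integral_eq_integral) (auto simp: square_integrable_rv_def intro: ennreal_leI)
    also have "\<dots> = ennreal (K * p * \<rho> ^ k) * ennreal m"
      using real(1) Kp \<rho> by (intro ennreal_mult) auto
    finally show ?thesis by (simp only: real(2) x_def)
  qed
  then show ?thesis unfolding ms_exp_stable_def using \<rho> Kp by blast
qed

text \<open>The independence hypothesis makes every deterministic initial condition admissible in
  \<open>ms_exp_stable\<close>, so that stability with zero delays does constrain the
  matrices.\<close>

theorem theorem4p11:
  fixes M :: "'w measure"
    and N :: nat
    and A :: "nat \<Rightarrow> real^'n^'n"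
    and \<nu> :: "nat \<Rightarrow> nat \<Rightarrow> 'w \<Rightarrow> real"
  assumes "prob_space M"
    and "zero_mean_unit_variance M N \<nu>"
    and "\<And>(\<tau> :: nat \<Rightarrow> nat) (c :: int \<Rightarrow> real^'n). noise_state_indep M N A \<nu> \<tau> (\<lambda>s \<omega>. c s)"
  shows "(\<forall>\<tau> :: nat \<Rightarrow> nat. ms_exp_stable M N A \<nu> \<tau>) \<longleftrightarrow> ms_exp_stable M N A \<nu> (\<lambda>_. 0)"
proof
  assume stable: "ms_exp_stable M N A \<nu> (\<lambda>_. 0)"
  obtain m where "0 < m" "\<And>c. c \<bullet> ((lyap_op N A ^^ m) (mat 1) *v c) \<le> (1/2) * (norm c)\<^sup>2"
    using zero_delay_contraction[OF assms(1,2) assms(3) stable] by blast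
  then obtain P where "\<And>x. (norm x)\<^sup>2 \<le> x \<bullet> (P *v x)"
    and "\<And>x. x \<bullet> (lyap_op N A P *v x) \<le> x \<bullet> (P *v x) - (1/2) * (norm x)\<^sup>2"
    using lyapunov_matrix by blast
  then show "\<forall>\<tau>. ms_exp_stable M N A \<nu> \<tau>"
    using ms_exp_stable_of_lyapunov[OF assms(1,2)] by blast
qed blast

end
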